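(* For every even positive integer $n$ there is a polytope $Q_n \subseteq [0,1]^n$ such that: (1) $\mathcal{P}_{n/2,n} = \mathrm{conv}(Q_n \cap \mathbb{Z}^n)$; and (2) $d\big(\mathcal{P}_{n/2,n},\, (\mathcal{P}_{n/2,n})^k \cap Q_n\big) = \Omega(\sqrt{n})$ for all $k \le n/2$. Here (2) means: there are absolute constants $c > 0$ and $n_0$ such that for all even $n \ge n_0$ and all positive integers $k \le n/2$, $d\big(\mathcal{P}_{n/2,n},\, (\mathcal{P}_{n/2,n})^k \cap Q_n\big) \ge c\sqrt{n}$.
   Context: For a real $t$ and a positive integer $n$, $\mathcal{P}_{t,n} = \{x \in [0,1]^n : \sum_{i=1}^n x_i \le t\}$. An inequality $\alpha x \le \beta$ (with $\alpha\in\mathbb{R}^n$, $\beta\in\mathbb{R}$, and $\alpha x$ denoting the inner product) is called $k$-sparse if $\alpha$ has at most $k$ non-zero components. It is valid for $P\subseteq\mathbb{R}^n$ if it is satisfied by all points of $P$. For a polytope $P \subset \mathbb{R}^n$ and a positive integer $k$, $P^k$ denotes the set of points of $\mathbb{R}^n$ satisfying all $k$-sparse inequalities valid for $P$. For polytopes $P \subseteq Q$ in $\mathbb{R}^n$, $d(P,Q) = \max_{x\in Q}\min_{y \in P}\|x-y\|$, where $\|\cdot\|$ is the Euclidean norm. *)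

theory Defs
  imports "HOL-Analysis.Analysis" "HOL-Analysis.Finite_Function_Topology"
begin

(* R^n for a variable n: the finitely supported real sequences whose support lies in {..<n},
   with coordinates numbered 0, ..., n-1. The vector space operations, and hence the library's
   convex hull and polytope, are coordinatewise. Pitfall: the norm and dist that the library
   puts on this type are the l1 ones, so the Euclidean distance is euclid_dist below. *)
type_synonym rvec = "nat \<Rightarrow>\<^sub>0 real"

definition Rn :: "nat \<Rightarrow> rvec set" where
  "Rn n = {x. Poly_Mapping.keys x \<subseteq> {..<n}}"

definition Zn :: "nat \<Rightarrow> rvec set" where
  "Zn n = {x \<in> Rn n. \<forall>i<n. Poly_Mapping.lookup x i \<in> \<int>}"

definition cube :: "nat \<Rightarrow> rvec set" where
  "cube n = {x \<in> Rn n. \<forall>i<n. 0 \<le> Poly_Mapping.lookup x i \<and> Poly_Mapping.lookup x i \<le> 1}"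

definition cardP :: "real \<Rightarrow> nat \<Rightarrow> rvec set" where
  "cardP t n = {x \<in> cube n. (\<Sum>i<n. Poly_Mapping.lookup x i) \<le> t}"

definition dotp :: "nat \<Rightarrow> rvec \<Rightarrow> rvec \<Rightarrow> real" where
  "dotp n a x = (\<Sum>i<n. Poly_Mapping.lookup a i * Poly_Mapping.lookup x i)"

definition valid_ineq :: "nat \<Rightarrow> rvec \<Rightarrow> real \<Rightarrow> rvec set \<Rightarrow> bool" where
  "valid_ineq n a b P \<longleftrightarrow> (\<forall>x\<in>P. dotp n a x \<le> b)"

(* keys a is the set of indices of the non-zero components of a *)
definition sparse :: "nat \<Rightarrow> rvec \<Rightarrow> bool" where
  "sparse k a \<longleftrightarrow> card (Poly_Mapping.keys a) \<le> k"

definition sparse_closure :: "nat \<Rightarrow> nat \<Rightarrow> rvec set \<Rightarrow> rvec set" where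
  "sparse_closure n k P =
     {x \<in> Rn n. \<forall>a\<in>Rn n. \<forall>b. sparse k a \<and> valid_ineq n a b P \<longrightarrow> dotp n a x \<le> b}"

definition euclid_dist :: "nat \<Rightarrow> rvec \<Rightarrow> rvec \<Rightarrow> real" where
  "euclid_dist n x y = L2_set (\<lambda>i. Poly_Mapping.lookup x i - Poly_Mapping.lookup y i) {..<n}"

(* For nonempty compact P and Q, in particular for nonempty polytopes, the supremum and the
   infimum are attained, i.e. they are the maximum and the minimum. *)
definition poly_dist :: "nat \<Rightarrow> rvec set \<Rightarrow> rvec set \<Rightarrow> real" where
  "poly_dist n P Q = (SUP x\<in>Q. INF y\<in>P. euclid_dist n x y)"

end

theory Submission
  imports Defs
begin

text \<open>Since \<open>k \<le> n/2\<close>, every point of the cube agrees on the support of a \<open>k\<close>-sparse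
  inequality with some point of \<open>\<P>\<^bsub>n/2,n\<^esub>\<close>, so the sparse closure contains the whole cube.
  It therefore suffices to find \<open>Q\<close> far from \<open>\<P>\<^bsub>n/2,n\<^esub>\<close>. Take the convex hull of
  \<open>\<P>\<^bsub>n/2,n\<^esub>\<close> and the constant vector \<open>3/4\<close>: a vertex of the cube cannot be a convex combination
  that involves this interior point, so no integer point is added, while Cauchy--Schwarz puts
  that vector at distance at least \<open>\<surd>n/4\<close>.\<close>

section \<open>Coordinates of finitely supported sequences and convexity\<close>

abbreviation coord :: "rvec \<Rightarrow> nat \<Rightarrow> real" where
  "coord \<equiv> Poly_Mapping.lookup"

text \<open>Truncating at \<open>n\<close> makes the support finite, as
  \<open>Abs_poly_mapping\<close> requires, so every \<open>f\<close> yields a point of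
  \<open>Rn n\<close>.\<close>

definition to_rvec :: "nat \<Rightarrow> (nat \<Rightarrow> real) \<Rightarrow> rvec" where
  "to_rvec n f = Abs_poly_mapping (\<lambda>i. if i < n then f i else 0)"

lemma coord_to_rvec [simp]: "coord (to_rvec n f) i = (if i < n then f i else 0)"
  unfolding to_rvec_def by (subst lookup_Abs_poly_mapping) auto

lemma coord_scaleR [simp]: "coord (r *\<^sub>R x) i = r * coord x i" for x :: rvec
proof -
  have "{i. r * coord x i \<noteq> 0} \<subseteq> Poly_Mapping.keys x"
    by (auto simp: in_keys_iff)
  then have "finite {i. r * coord x i \<noteq> 0}"
    by (rule finite_subset) simp
  then show ?thesis
    by (simp add: scaleR_poly_mapping_def)
qed

lemma Rn_iff: "x \<in> Rn n \<longleftrightarrow> (\<forall>i\<ge>n. coord x i = 0)"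
  unfolding Rn_def by (force simp: in_keys_iff not_less[symmetric])

lemma to_rvec_in_Rn [simp]: "to_rvec n f \<in> Rn n"
  by (simp add: Rn_iff)

lemma Rn_eqI: "x \<in> Rn n \<Longrightarrow> y \<in> Rn n \<Longrightarrow> (\<And>i. i < n \<Longrightarrow> coord x i = coord y i) \<Longrightarrow> x = y"
  by (metis Rn_iff not_less poly_mapping_eqI)

lemma to_rvec_in_cube [simp]: "to_rvec n f \<in> cube n \<longleftrightarrow> (\<forall>i<n. 0 \<le> f i \<and> f i \<le> 1)"
  by (simp add: cube_def)

lemma convex_cube: "convex (cube n)"
proof (rule convexI)
  fix x y :: rvec and u v :: real
  assume "x \<in> cube n" "y \<in> cube n" "0 \<le> u" "0 \<le> v" "u + v = 1"
  then show "u *\<^sub>R x + v *\<^sub>R y \<in> cube n"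
    by (auto simp: cube_def Rn_iff lookup_add intro!: convex_bound_le)
qed

lemma convex_cardP: "convex (cardP t n)"
proof (rule convexI)
  fix x y :: rvec and u v :: real
  assume *: "x \<in> cardP t n" "y \<in> cardP t n" "0 \<le> u" "0 \<le> v" "u + v = 1"
  then have "u *\<^sub>R x + v *\<^sub>R y \<in> cube n"
    using convexD[OF convex_cube] by (simp add: cardP_def)
  moreover have "(\<Sum>i<n. coord (u *\<^sub>R x + v *\<^sub>R y) i) = u * (\<Sum>i<n. coord x i) + v * (\<Sum>i<n. coord y i)"
    by (simp add: lookup_add sum.distrib sum_distrib_left)
  moreover have "\<dots> \<le> t"
    using * by (intro convex_bound_le) (auto simp: cardP_def)
  ultimately show "u *\<^sub>R x + v *\<^sub>R y \<in> cardP t n"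
    by (simp add: cardP_def)
qed

section \<open>Integer points and integrality of the cardinality polytope\<close>

lemma cube_Zn_coord: "x \<in> cube n \<Longrightarrow> x \<in> Zn n \<Longrightarrow> i < n \<Longrightarrow> coord x i = 0 \<or> coord x i = 1"
  unfolding cube_def Zn_def by (force elim!: Ints_cases)

text \<open>The points are indicator vectors of subsets of \<open>{..<n}\<close>. Finiteness is what
  later makes \<open>bulged n\<close> a polytope.\<close>

lemma finite_cube_Zn: "finite (cube n \<inter> Zn n)"
proof (rule finite_subset)
  show "cube n \<inter> Zn n \<subseteq> (\<lambda>S. to_rvec n (indicator S)) ` Pow {..<n}"
  proof
    fix x assume x: "x \<in> cube n \<inter> Zn n"
    have "x = to_rvec n (indicator {i. i < n \<and> coord x i = 1})"
      by (rule Rn_eqI[of _ n])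
        (use x cube_Zn_coord[of x n] in \<open>auto simp: Zn_def indicator_def\<close>)
    then show "x \<in> (\<lambda>S. to_rvec n (indicator S)) ` Pow {..<n}"
      by blast
  qed
qed simp

text \<open>Its cardinality is the induction measure in \<open>cardP_subset_hull\<close>.\<close>

definition frac_coords :: "nat \<Rightarrow> rvec \<Rightarrow> nat set" where
  "frac_coords n x = {i. i < n \<and> coord x i \<notin> \<int>}"

lemma finite_frac_coords [simp]: "finite (frac_coords n x)"
  by (simp add: frac_coords_def)

lemma cube_frac_coords:
  "x \<in> cube n \<Longrightarrow> i \<in> frac_coords n x \<Longrightarrow> i < n \<and> 0 < coord x i \<and> coord x i < 1"
  unfolding cube_def frac_coords_def by (force simp: less_le)

lemma sum_fun_upd:
  fixes f :: "nat \<Rightarrow> real"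
  assumes "i < n"
  shows "(\<Sum>l<n. (f(i := a)) l) = (\<Sum>l<n. f l) - f i + a"
  using assms by (simp add: sum.remove[of "{..<n}" i] sum.remove[of "{..<n}" i f])

lemma convex_comb_in_hull:
  assumes "y \<in> convex hull S" "z \<in> convex hull S" "0 \<le> u" "u \<le> 1"
    and "x \<in> Rn n" "y \<in> Rn n" "z \<in> Rn n"
    and "\<And>i. i < n \<Longrightarrow> coord x i = u * coord y i + (1 - u) * coord z i"
  shows "x \<in> convex hull S"
proof -
  have "x = u *\<^sub>R y + (1 - u) *\<^sub>R z"
    by (rule Rn_eqI[of _ n]) (use assms in \<open>auto simp: Rn_iff lookup_add\<close>)
  then show ?thesis
    using convexD[OF convex_convex_hull assms(1,2), of u "1 - u"] assms(3,4) by simp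
qed

text \<open>Two fractional coordinates can be shifted against each other, in both directions, until one
  of them becomes integral. A single fractional coordinate can be rounded both ways, since then the
  rounded-up sum is an integer below \<open>m + 1\<close>.\<close>

lemma cardP_subset_hull: "x \<in> cardP (real m) n \<Longrightarrow> x \<in> convex hull (cardP (real m) n \<inter> Zn n)"
proof (induction "card (frac_coords n x)" arbitrary: x rule: less_induct)
  case less
  let ?H = "convex hull (cardP (real m) n \<inter> Zn n)"
  have xC: "x \<in> cube n" and xR: "x \<in> Rn n" and xm: "(\<Sum>i<n. coord x i) \<le> m"
    using less.prems by (auto simp: cardP_def cube_def)
  have IH: "to_rvec n f \<in> ?H"
    if "\<And>i. i < n \<Longrightarrow> 0 \<le> f i \<and> f i \<le> 1" "(\<Sum>i<n. f i) \<le> m" "frac_coords n (to_rvec n f) \<subset> frac_coords n x"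
    for f :: "nat \<Rightarrow> real"
    using that by (intro less.hyps psubset_card_mono) (auto simp: cardP_def)
  show ?case
  proof (cases "frac_coords n x = {}")
    case True
    then show ?thesis
      using less.prems xR by (intro hull_inc) (auto simp: frac_coords_def Zn_def)
  next
    case False
    then obtain i where i: "i \<in> frac_coords n x" by blast
    note ib = cube_frac_coords[OF xC i]
    show ?thesis
    proof (cases "frac_coords n x = {i}")
      case True
      have in_Ints: "coord x l \<in> \<int>" if "l < n" "l \<noteq> i" for l
        using True that by (auto simp: frac_coords_def)
      let ?y = "\<lambda>a. (coord x)(i := a)"
      have F: "frac_coords n (to_rvec n (?y a)) \<subset> frac_coords n x" if "a \<in> \<int>" for a
        using that in_Ints i unfolding True by (auto simp: frac_coords_def split: if_splits)
      have S: "(\<Sum>l<n. ?y a l) = (\<Sum>l<n. coord x l) - coord x i + a" for a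
        using ib by (intro sum_fun_upd) auto
      have "(\<Sum>l<n. ?y 1 l) \<in> \<int>"
        using in_Ints by (intro Ints_sum) auto
      then obtain N where N: "(\<Sum>l<n. ?y 1 l) = of_int N"
        by (auto elim: Ints_cases)
      have "N < int m + 1"
        using N S[of 1] xm ib by linarith
      then have "(\<Sum>l<n. ?y 1 l) \<le> m"
        unfolding N by linarith
      then have y1: "to_rvec n (?y 1) \<in> ?H"
        using xC F[of 1] by (intro IH) (auto simp: cube_def)
      have "(\<Sum>l<n. ?y 0 l) \<le> m"
        unfolding S using xm ib by linarith
      then have y0: "to_rvec n (?y 0) \<in> ?H"
        using xC F[of 0] by (intro IH) (auto simp: cube_def)
      show ?thesis
        by (rule convex_comb_in_hull[OF y1 y0, where u = "coord x i" and n = n])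
          (use ib xR in \<open>auto simp: algebra_simps\<close>)
    next
      case False
      then obtain j where j: "j \<in> frac_coords n x" "j \<noteq> i"
        using i by blast
      note jb = cube_frac_coords[OF xC j(1)]
      define s where "s = coord x i + coord x j"
      let ?y = "\<lambda>a b. (coord x)(i := a, j := b)"
      have F: "frac_coords n (to_rvec n (?y a b)) \<subset> frac_coords n x" if "a \<in> \<int> \<or> b \<in> \<int>" for a b
        using that i j by (auto simp: frac_coords_def split: if_splits)
      have S: "(\<Sum>l<n. ?y a b l) = (\<Sum>l<n. coord x l)" if "a + b = s" for a b
        using ib jb j(2) that by (simp only: sum_fun_upd) (simp add: s_def)
      have y: "to_rvec n (?y a b) \<in> ?H"
        if "a + b = s" "a \<in> \<int> \<or> b \<in> \<int>" "0 \<le> a" "a \<le> 1" "0 \<le> b" "b \<le> 1" for a b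
        using xC xm S[OF that(1)] F[OF that(2)] that(3-) by (intro IH) (auto simp: cube_def)
      \<comment> \<open>The two points carry the same pair of values at \<open>i\<close> and
        \<open>j\<close>, in swapped order. As \<open>a + b = s\<close>, a weight that is right at
        \<open>i\<close> is automatically right at \<open>j\<close>.\<close>
      have combine: "x \<in> ?H"
        if ab: "a + b = s" "a \<in> \<int> \<or> b \<in> \<int>" "0 \<le> a" "a \<le> 1" "0 \<le> b" "b \<le> 1"
          and u: "0 \<le> u" "u \<le> 1" and xi: "u * a + (1 - u) * b = coord x i" for a b u
      proof (rule convex_comb_in_hull)
        show "to_rvec n (?y a b) \<in> ?H" "to_rvec n (?y b a) \<in> ?H"
          using ab by (auto intro!: y)
        fix l assume l: "l < n"
        have xj: "u * b + (1 - u) * a = coord x j"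
          using xi ab(1) by (simp add: s_def algebra_simps)
        consider "l = i" | "l = j" | "l \<noteq> i" "l \<noteq> j" by blast
        then show "coord x l = u * coord (to_rvec n (?y a b)) l + (1 - u) * coord (to_rvec n (?y b a)) l"
        proof cases
          case 1
          then show ?thesis using l j(2) xi by simp
        next
          case 2
          then show ?thesis using l xj by simp
        next
          case 3
          then show ?thesis using l by (simp add: left_diff_distrib)
        qed
      qed (use u xR in auto)
      show ?thesis
      \<comment> \<open>The line of points with sum \<open>s\<close> meets the unit square in a
        segment with endpoints \<open>(s, 0)\<close> and \<open>(0, s)\<close> if \<open>s\<close>
        is at most 1, and \<open>(1, s - 1)\<close> and \<open>(s - 1, 1)\<close> otherwise. Each
        endpoint has an integral entry.\<close>
      proof (cases "s \<le> 1")
        case True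
        have "s > 0" using ib jb by (simp add: s_def)
        then show ?thesis
          using True ib jb by (intro combine[of s 0 "coord x i / s"]) (simp_all add: s_def)
      next
        case False
        \<comment> \<open>This solves \<open>u + (1 - u) * (s - 1) = coord x i\<close>, since
          \<open>coord x i - s + 1 = 1 - coord x j\<close>.\<close>
        define u where "u = (1 - coord x j) / (2 - s)"
        have s: "2 - s > 0" using ib jb by (simp add: s_def)
        then have "u * (2 - s) = 1 - coord x j" by (simp add: u_def)
        then have "u * 1 + (1 - u) * (s - 1) = coord x i"
          by (simp add: s_def algebra_simps)
        moreover have "0 \<le> u" "u \<le> 1"
          using s ib jb by (simp_all add: u_def s_def)
        ultimately show ?thesis
          using s False by (intro combine[of 1 "s - 1" u]) simp_all
      qed
    qed
  qed
qed

lemma cardP_eq_hull: "cardP (real m) n = convex hull (cardP (real m) n \<inter> Zn n)"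
proof
  show "cardP (real m) n \<subseteq> convex hull (cardP (real m) n \<inter> Zn n)"
    using cardP_subset_hull by blast
  show "convex hull (cardP (real m) n \<inter> Zn n) \<subseteq> cardP (real m) n"
    by (rule hull_minimal[where S = convex]) (simp_all add: convex_cardP)
qed

section \<open>The sparse closure contains the cube\<close>

lemma cube_subset_sparse_closure:
  assumes "real k \<le> t"
  shows "cube n \<subseteq> sparse_closure n k (cardP t n)"
proof
  fix x assume x: "x \<in> cube n"
  have "dotp n a x \<le> b" if a: "sparse k a" "a \<in> Rn n" "valid_ineq n a b (cardP t n)" for a b
  proof -
    \<comment> \<open>Zeroing \<open>x\<close> off the support of \<open>a\<close> keeps the inner
      product with \<open>a\<close> and leaves at most \<open>k\<close> entries, each at most 1, so
      the sum is at most \<open>t\<close>.\<close>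
    define y where "y = to_rvec n (\<lambda>i. if i \<in> Poly_Mapping.keys a then coord x i else 0)"
    have "(\<Sum>i<n. coord y i) = (\<Sum>i\<in>{..<n} \<inter> Poly_Mapping.keys a. coord x i)"
      unfolding y_def by (auto simp: sum.inter_restrict)
    also have "\<dots> \<le> (\<Sum>i\<in>{..<n} \<inter> Poly_Mapping.keys a. 1)"
      using x by (intro sum_mono) (auto simp: cube_def)
    also have "\<dots> \<le> real (card (Poly_Mapping.keys a))"
      by (simp add: card_mono)
    also have "\<dots> \<le> t"
      using assms a(1) by (simp add: sparse_def)
    finally have "y \<in> cardP t n"
      using x by (auto simp: cardP_def y_def cube_def)
    moreover have "dotp n a x = dotp n a y"
      unfolding dotp_def y_def by (intro sum.cong) (auto simp: in_keys_iff)
    ultimately show ?thesis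
      using a(3) by (auto simp: valid_ineq_def)
  qed
  then show "x \<in> sparse_closure n k (cardP t n)"
    using x by (auto simp: sparse_closure_def cube_def)
qed

section \<open>Distance estimates\<close>

lemma sum_diff_le_euclid_dist:
  "(\<Sum>i<n. coord x i) - (\<Sum>i<n. coord y i) \<le> sqrt n * euclid_dist n x y"
proof -
  \<comment> \<open>The factors 1 prepare Cauchy--Schwarz against the all-ones vector, whose
    Euclidean norm is \<open>sqrt n\<close>.\<close>
  have "(\<Sum>i<n. coord x i) - (\<Sum>i<n. coord y i) \<le> (\<Sum>i<n. \<bar>1\<bar> * \<bar>coord x i - coord y i\<bar>)"
    unfolding sum_subtractf[symmetric] by (intro sum_mono) auto
  also have "\<dots> \<le> L2_set (\<lambda>_. 1) {..<n} * euclid_dist n x y"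
    unfolding euclid_dist_def by (rule L2_set_mult_ineq)
  finally show ?thesis
    by (simp add: L2_set_def)
qed

text \<open>A crude bound suffices: it serves to bound the supremum in
  \<open>poly_dist\<close>.\<close>

lemma euclid_dist_cube_le:
  assumes "x \<in> cube n" "y \<in> cube n"
  shows "euclid_dist n x y \<le> n"
proof -
  have "euclid_dist n x y \<le> (\<Sum>i<n. \<bar>coord x i - coord y i\<bar>)"
    unfolding euclid_dist_def by (rule L2_set_le_sum_abs)
  also have "\<dots> \<le> (\<Sum>i<n. 1)"
  proof (rule sum_mono)
    fix i assume "i \<in> {..<n}"
    then have "0 \<le> coord x i" "coord x i \<le> 1" "0 \<le> coord y i" "coord y i \<le> 1"
      using assms by (simp_all add: cube_def)
    then show "\<bar>coord x i - coord y i\<bar> \<le> 1" by linarith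
  qed
  finally show ?thesis by simp
qed

lemma euclid_dist_nonneg: "0 \<le> euclid_dist n x y"
  by (simp add: euclid_dist_def L2_set_nonneg)

text \<open>Over the reals, \<open>SUP\<close> and \<open>INF\<close> obey their order laws only for
  nonempty bounded sets. Containment in the cube supplies the upper bound and nonnegativity of the
  distance the lower one.\<close>

lemma poly_dist_ge:
  assumes "P \<noteq> {}" "P \<subseteq> cube n" "Q \<subseteq> cube n" "x \<in> Q" "\<And>y. y \<in> P \<Longrightarrow> d \<le> euclid_dist n x y"
  shows "d \<le> poly_dist n P Q"
proof -
  have bdd: "bdd_below (euclid_dist n z ` P)" for z
    using euclid_dist_nonneg by (intro bdd_belowI2)
  have "d \<le> (INF y\<in>P. euclid_dist n x y)"
    using assms by (intro cINF_greatest)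
  also have "\<dots> \<le> poly_dist n P Q"
    unfolding poly_dist_def
  proof (rule cSUP_upper[OF \<open>x \<in> Q\<close>], rule bdd_aboveI2)
    obtain y where "y \<in> P" using assms(1) by blast
    then show "(INF y\<in>P. euclid_dist n z y) \<le> real n" if "z \<in> Q" for z
      using that assms(2,3) by (intro cINF_lower2[OF bdd] euclid_dist_cube_le) auto
  qed
  finally show ?thesis .
qed

section \<open>The polytope far from the cardinality polytope\<close>

text \<open>Generating from integer points keeps the generating set finite; for even
  \<open>n\<close> the hull is the same as with all of \<open>cardP (real n / 2) n\<close>. The
  value 3/4 lies strictly between 1/2, to exceed the sum bound by a multiple of \<open>n\<close>,
  and 1, to add no integer point.\<close>

definition bulged :: "nat \<Rightarrow> rvec set" where
  "bulged n = convex hull (insert (to_rvec n (\<lambda>_. 3/4)) (cardP (real n / 2) n \<inter> Zn n))"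

lemma polytope_bulged: "polytope (bulged n)"
  unfolding bulged_def polytope_def
  by (intro exI conjI refl) (auto intro: finite_subset[OF _ finite_cube_Zn[of n]] simp: cardP_def)

lemma bulged_subset_cube: "bulged n \<subseteq> cube n"
  unfolding bulged_def by (intro hull_minimal convex_cube) (auto simp: cardP_def)

lemma zero_in_cardP_Zn: "0 \<le> t \<Longrightarrow> to_rvec n (\<lambda>_. 0) \<in> cardP t n \<inter> Zn n"
  by (simp add: cardP_def Zn_def)

lemma bulged_Int_Zn:
  assumes "n > 0" "even n"
  shows "bulged n \<inter> Zn n = cardP (real n / 2) n \<inter> Zn n"
proof -
  obtain m where "n = 2 * m" using assms(2) by (elim evenE)
  then have m: "real n / 2 = real m" by simp
  have "x \<in> cardP (real m) n" if x: "x \<in> bulged n" "x \<in> Zn n" for x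
  proof -
    have ne: "cardP (real m) n \<inter> Zn n \<noteq> {}"
      using zero_in_cardP_Zn[of "real m"] by fastforce
    obtain u v b where uv: "0 \<le> u" "0 \<le> v" "u + v = 1"
      and b: "b \<in> cardP (real m) n" and xeq: "x = u *\<^sub>R to_rvec n (\<lambda>_. 3/4) + v *\<^sub>R b"
      using x(1) unfolding bulged_def m convex_hull_insert[OF ne] cardP_eq_hull[symmetric] by auto
    \<comment> \<open>One coordinate is enough. The value 0 forces \<open>u = 0\<close> as both
      summands are nonnegative; the value 1 does so because the right side is at most
      \<open>3/4 * u + v = 1 - u/4\<close>.\<close>
    have "coord x 0 = u * (3/4) + v * coord b 0"
      using assms(1) by (simp add: xeq lookup_add)
    moreover have "0 \<le> v * coord b 0" "v * coord b 0 \<le> v"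
      using b assms(1) uv by (auto simp: cardP_def cube_def mult_left_le)
    moreover have "coord x 0 = 0 \<or> coord x 0 = 1"
      using cube_Zn_coord x bulged_subset_cube assms(1) by blast
    ultimately have "u = 0"
      using uv by linarith
    then show ?thesis using uv b xeq by simp
  qed
  then show ?thesis
    by (auto simp: m bulged_def intro: hull_inc)
qed

theorem theorem5:
  shows "\<exists>Q :: nat \<Rightarrow> rvec set.
    (\<forall>n>0. even n \<longrightarrow>
       polytope (Q n) \<and> Q n \<subseteq> cube n \<and>
       cardP (real n / 2) n = convex hull (Q n \<inter> Zn n)) \<and>
    (\<exists>c>0. \<exists>n0. \<forall>n\<ge>n0. n > 0 \<and> even n \<longrightarrow>
       (\<forall>k>0. real k \<le> real n / 2 \<longrightarrow>
          poly_dist n (cardP (real n / 2) n)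
            (sparse_closure n k (cardP (real n / 2) n) \<inter> Q n) \<ge> c * sqrt (real n)))"
\<comment> \<open>The constant 1/4 is 3/4 - 1/2: the coordinate sums differ by at least
  \<open>n/4\<close>, and Cauchy--Schwarz costs a factor \<open>sqrt n\<close>.\<close>
proof (intro exI[of _ bulged] conjI exI[of _ "1/4::real"] exI[of _ "0::nat"] allI impI)
  fix n :: nat assume n: "0 < n" "even n"
  then obtain m where "n = 2 * m" by (elim evenE)
  then have m: "real n / 2 = real m" by simp
  show "cardP (real n / 2) n = convex hull (bulged n \<inter> Zn n)"
    unfolding bulged_Int_Zn[OF n] m by (rule cardP_eq_hull)
next
  fix n k :: nat
  assume n: "0 < n \<and> even n" and k: "real k \<le> real n / 2"
  let ?p = "to_rvec n (\<lambda>_. 3/4)"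
  show "1/4 * sqrt (real n) \<le> poly_dist n (cardP (real n / 2) n)
      (sparse_closure n k (cardP (real n / 2) n) \<inter> bulged n)"
  proof (rule poly_dist_ge)
    show "cardP (real n / 2) n \<noteq> {}"
      using zero_in_cardP_Zn[of "real n / 2" n] by auto
    show "cardP (real n / 2) n \<subseteq> cube n"
      by (auto simp: cardP_def)
    show "sparse_closure n k (cardP (real n / 2) n) \<inter> bulged n \<subseteq> cube n"
      using bulged_subset_cube by blast
    show "?p \<in> sparse_closure n k (cardP (real n / 2) n) \<inter> bulged n"
      using cube_subset_sparse_closure[OF k, of n] by (auto simp: bulged_def intro: hull_inc)
    show "1/4 * sqrt (real n) \<le> euclid_dist n ?p y" if "y \<in> cardP (real n / 2) n" for y
    proof -
      have "sqrt n * (1/4 * sqrt n) = 3/4 * real n - real n / 2"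
        by simp
      also have "\<dots> \<le> (\<Sum>i<n. coord ?p i) - (\<Sum>i<n. coord y i)"
        using that by (simp add: cardP_def)
      also have "\<dots> \<le> sqrt n * euclid_dist n ?p y"
        by (rule sum_diff_le_euclid_dist)
      finally show ?thesis
        using n by (subst (asm) mult_le_cancel_left_pos) auto
    qed
  qed
qed (use polytope_bulged bulged_subset_cube in auto)

end
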